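(* Let $G$ be a connected cubic graph, $F$ a $1$-factor of $G$ and $X=G/F$. Then $X$ admits a decomposition of its edge set into a blue $2$-factor and a red $2$-factor such that the traversing transitions are exactly the color-switching transitions and the non-traversing transitions are exactly the color-preserving transitions if and only if $F$ is special.
   Context: Let $Y=G-F$. $X=G/F$ is obtained by contracting each edge $e=uv\in F$ to a vertex $x_e$; its edges are the edges of $Y$, and the four edge-ends at $x_e$ correspond to the edge-ends of $Y$ at $u$ and $v$. A transition at $x_e$ is an unordered pair of distinct edge-ends at $x_e$; non-traversing if both come from the same end of $e$, traversing otherwise. A transition is color-switching if its two edge-ends belong to edges of different colors and color-preserving otherwise. The auxiliary graph $Y(G,F)$ has the cycles of $Y$ as vertices, two of them adjacent iff joined by at least one edge of $F$, with a loop at a cycle if some edge of $F$ is a chord of that cycle. $F$ is special if $Y(G,F)$ is bipartite (in particular loopless). *)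

theory Defs
  imports "Graph_Theory.Graph_Theory"
begin

text \<open>
  An undirected graph, possibly with loops and parallel edges, is a \<^locale>\<open>bidirected_digraph\<close>:
  the involution \<open>arev\<close> pairs the arcs, \<open>{a, arev a}\<close> is an edge, and the arc \<open>a\<close> itself is the
  edge-end of that edge at \<open>tail G a\<close>. Hence a loop has two edge-ends at its vertex, the degree of
  a vertex is its \<^const>\<open>out_degree\<close>, and a set of edges is a set of arcs closed under \<open>arev\<close>.
\<close>

definition regular :: "nat \<Rightarrow> ('v, 'e) pre_digraph \<Rightarrow> bool" where
  "regular k G \<longleftrightarrow> (\<forall>v \<in> verts G. out_degree G v = k)"

abbreviation cubic :: "('v, 'e) pre_digraph \<Rightarrow> bool" where
  "cubic G \<equiv> regular 3 G"

definition edge_subset :: "('v, 'e) pre_digraph \<Rightarrow> ('e \<Rightarrow> 'e) \<Rightarrow> 'e set \<Rightarrow> bool" where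
  "edge_subset G arev S \<longleftrightarrow> S \<subseteq> arcs G \<and> (\<forall>a \<in> S. arev a \<in> S)"

definition is_factor :: "nat \<Rightarrow> ('v, 'e) pre_digraph \<Rightarrow> ('e \<Rightarrow> 'e) \<Rightarrow> 'e set \<Rightarrow> bool" where
  "is_factor k G arev S \<longleftrightarrow> edge_subset G arev S \<and> regular k (G\<lparr>arcs := S\<rparr>)"

definition edges_of :: "('e \<Rightarrow> 'e) \<Rightarrow> 'e set \<Rightarrow> 'e set set" where
  "edges_of arev S = (\<lambda>a. {a, arev a}) ` S"

definition delete_edges :: "('v, 'e) pre_digraph \<Rightarrow> 'e set \<Rightarrow> ('v, 'e) pre_digraph" where
  "delete_edges G F = G\<lparr>arcs := arcs G - F\<rparr>"

text \<open>
  For an edge \<open>e = {a, arev a}\<close> the set of its end vertices is \<open>tail G ` e\<close>. The vertex \<open>x\<^sub>e\<close> of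
  \<open>G/F\<close> is \<open>e\<close> itself; if \<open>F\<close> is a 1-factor, exactly one edge of \<open>F\<close> is incident with a given vertex.
\<close>

definition factor_edge_at :: "('v, 'e) pre_digraph \<Rightarrow> ('e \<Rightarrow> 'e) \<Rightarrow> 'e set \<Rightarrow> 'v \<Rightarrow> 'e set" where
  "factor_edge_at G arev F v = (THE e. e \<in> edges_of arev F \<and> v \<in> tail G ` e)"

definition contract_factor ::
    "('v, 'e) pre_digraph \<Rightarrow> ('e \<Rightarrow> 'e) \<Rightarrow> 'e set \<Rightarrow> ('e set, 'e) pre_digraph" where
  "contract_factor G arev F =
     \<lparr> verts = edges_of arev F,
       arcs = arcs (delete_edges G F),
       tail = (\<lambda>a. factor_edge_at G arev F (tail G a)),
       head = (\<lambda>a. factor_edge_at G arev F (head G a)) \<rparr>"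

definition transitions_at :: "('v, 'e) pre_digraph \<Rightarrow> 'v \<Rightarrow> 'e set set" where
  "transitions_at H x = {{a, b} |a b. a \<in> out_arcs H x \<and> b \<in> out_arcs H x \<and> a \<noteq> b}"

definition transitions :: "('v, 'e) pre_digraph \<Rightarrow> 'e set set" where
  "transitions H = (\<Union>x \<in> verts H. transitions_at H x)"

definition nontraversing_transitions ::
    "('v, 'e) pre_digraph \<Rightarrow> ('e \<Rightarrow> 'e) \<Rightarrow> 'e set \<Rightarrow> 'e set set" where
  "nontraversing_transitions G arev F =
     (\<Union>e \<in> edges_of arev F. {t \<in> transitions_at (contract_factor G arev F) e.
        \<exists>u \<in> tail G ` e. t \<subseteq> out_arcs (delete_edges G F) u})"

definition traversing_transitions ::
    "('v, 'e) pre_digraph \<Rightarrow> ('e \<Rightarrow> 'e) \<Rightarrow> 'e set \<Rightarrow> 'e set set" where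
  "traversing_transitions G arev F =
     transitions (contract_factor G arev F) - nontraversing_transitions G arev F"

definition color_switching_transitions ::
    "('v, 'e) pre_digraph \<Rightarrow> 'e set \<Rightarrow> 'e set \<Rightarrow> 'e set set" where
  "color_switching_transitions H B R =
     {t \<in> transitions H. \<exists>a \<in> t. \<exists>b \<in> t. a \<in> B \<and> b \<in> R}"

definition color_preserving_transitions ::
    "('v, 'e) pre_digraph \<Rightarrow> 'e set \<Rightarrow> 'e set \<Rightarrow> 'e set set" where
  "color_preserving_transitions H B R = transitions H - color_switching_transitions H B R"

text \<open>
  A cycle is a connected 2-regular subgraph, so a loop and a pair of parallel edges give cycles of
  length 1 and 2. The library's \<^const>\<open>pre_digraph.cycle\<close> is unsuitable here, since
  it admits the closed walk \<open>a, arev a\<close> along a single edge.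
\<close>

definition cycles_of :: "('v, 'e) pre_digraph \<Rightarrow> ('e \<Rightarrow> 'e) \<Rightarrow> ('v, 'e) pre_digraph set" where
  "cycles_of H arev =
     {C. subgraph C H \<and> edge_subset H arev (arcs C) \<and> Digraph_Component.connected C \<and> regular 2 C}"

definition joined_by :: "('v, 'e) pre_digraph \<Rightarrow> 'e set \<Rightarrow>
    ('v, 'e) pre_digraph \<Rightarrow> ('v, 'e) pre_digraph \<Rightarrow> bool" where
  "joined_by G F C D \<longleftrightarrow> (\<exists>a \<in> F. tail G a \<in> verts C \<and> head G a \<in> verts D)"

definition has_chord_in ::
    "('v, 'e) pre_digraph \<Rightarrow> 'e set \<Rightarrow> ('v, 'e) pre_digraph \<Rightarrow> bool" where
  "has_chord_in G F C \<longleftrightarrow> (\<exists>a \<in> F - arcs C. tail G a \<in> verts C \<and> head G a \<in> verts C)"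

definition aux_graph :: "('v, 'e) pre_digraph \<Rightarrow> ('e \<Rightarrow> 'e) \<Rightarrow> 'e set \<Rightarrow>
    ('v, 'e) pre_digraph pair_pre_digraph" where
  "aux_graph G arev F =
     (let Cs = cycles_of (delete_edges G F) arev in
     \<lparr> pverts = Cs,
       parcs = {(C, D). C \<in> Cs \<and> D \<in> Cs \<and> C \<noteq> D \<and> joined_by G F C D}
             \<union> {(C, C) |C. C \<in> Cs \<and> has_chord_in G F C} \<rparr>)"

definition bipartite :: "('v, 'e) pre_digraph \<Rightarrow> bool" where
  "bipartite H \<longleftrightarrow> (\<exists>U W. verts H = U \<union> W \<and> U \<inter> W = {} \<and> arcs_ends H \<subseteq> U \<times> W \<union> W \<times> U)"

definition special :: "('v, 'e) pre_digraph \<Rightarrow> ('e \<Rightarrow> 'e) \<Rightarrow> 'e set \<Rightarrow> bool" where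
  "special G arev F \<longleftrightarrow> bipartite (with_proj (aux_graph G arev F))"

lemma (in bidirected_digraph) factor_edge_at_eqI:
  assumes F: "is_factor 1 G arev F" and a: "a \<in> F" "tail G a = v"
  shows "factor_edge_at G arev F v = {a, arev a}"
  unfolding factor_edge_at_def
proof (rule the_equality)
  show "{a, arev a} \<in> edges_of arev F \<and> v \<in> tail G ` {a, arev a}"
    using a by (auto simp: edges_of_def)
next
  have sub: "F \<subseteq> arcs G" and closed: "\<And>b. b \<in> F \<Longrightarrow> arev b \<in> F"
    using F by (auto simp: is_factor_def edge_subset_def)
  have "v \<in> verts G" using a sub by auto
  then have "card {b \<in> F. tail G b = v} = 1"
    using F by (simp add: is_factor_def regular_def out_degree_def out_arcs_def)
  then obtain c where c: "{b \<in> F. tail G b = v} = {c}" by (auto simp: card_1_singleton_iff)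
  fix e assume e: "e \<in> edges_of arev F \<and> v \<in> tail G ` e"
  then obtain b where b: "b \<in> F" "e = {b, arev b}" by (auto simp: edges_of_def)
  from e b have "tail G b = v \<or> tail G (arev b) = v" by auto
  then have "b = c \<or> arev b = c" using c b closed by blast
  moreover have "a = c" using a c by blast
  ultimately show "e = {a, arev a}" using b by auto
qed

lemma (in bidirected_digraph) factor_edge_at_mem:
  assumes F: "is_factor 1 G arev F" and v: "v \<in> verts G"
  shows "factor_edge_at G arev F v \<in> edges_of arev F"
    and "v \<in> tail G ` factor_edge_at G arev F v"
proof -
  from F v have "card {b \<in> F. tail G b = v} = 1"
    by (simp add: is_factor_def regular_def out_degree_def out_arcs_def)
  then obtain c where "{b \<in> F. tail G b = v} = {c}" by (auto simp: card_1_singleton_iff)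
  then have c: "c \<in> F" "tail G c = v" by auto
  show "factor_edge_at G arev F v \<in> edges_of arev F"
    and "v \<in> tail G ` factor_edge_at G arev F v"
    unfolding factor_edge_at_eqI[OF F c] using c by (auto simp: edges_of_def)
qed

lemma (in bidirected_digraph) bidirected_contract_factor:
  assumes F: "is_factor 1 G arev F"
  shows "bidirected_digraph (contract_factor G arev F) (\<lambda>a. if a \<in> F then a else arev a)"
proof -
  have closed: "\<And>b. b \<in> F \<Longrightarrow> arev b \<in> F"
    using F by (auto simp: is_factor_def edge_subset_def)
  then have closed': "arev b \<in> F \<longleftrightarrow> b \<in> F" for b by (metis arev_arev)
  show ?thesis
    by unfold_locales
      (auto simp: contract_factor_def delete_edges_def closed' arev_dom[symmetric]
        intro: factor_edge_at_mem(1)[OF F] dest: arev_neq arev_eq)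
qed

end

theory Submission
  imports Defs
begin

text \<open>
  Both sides are equivalent to the existence of a 2-coloring of the vertices of \<open>G\<close> that is constant
  along the edges of \<open>Y = G - F\<close> and changes along the edges of \<open>F\<close>. If the non-traversing
  transitions preserve colors, the two edge-ends of \<open>Y\<close> at a vertex agree, so an edge coloring of
  \<open>X\<close> is a coloring of the vertices of \<open>G\<close>; the traversing transitions at \<open>x\<^sub>e\<close> switch colors iff
  the ends of \<open>e\<close> are colored differently. On the other hand, \<open>Y\<close> is 2-regular, so its cycles are
  its components, and a vertex coloring constant on components is a coloring of the vertices of
  \<open>Y(G,F)\<close>.
\<close>

definition switching_coloring :: "('v, 'e) pre_digraph \<Rightarrow> 'e set \<Rightarrow> ('v \<Rightarrow> bool) \<Rightarrow> bool" where
  "switching_coloring G F c \<longleftrightarrow>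
     (\<forall>a \<in> arcs G - F. c (tail G a) = c (head G a)) \<and> (\<forall>a \<in> F. c (tail G a) \<noteq> c (head G a))"

text \<open>Connectedness is reachability in the symmetric closure, so each step of the induction is
  an arc used in either direction. Applied to the cycles of \<open>Y - F\<close>-colorings, this
  makes a coloring of vertices a coloring of cycles.\<close>

lemma connected_constant:
  assumes "Digraph_Component.connected C"
    and "\<And>a. a \<in> arcs C \<Longrightarrow> c (tail C a) = c (head C a)"
    and "u \<in> verts C" "v \<in> verts C"
  shows "c u = c v"
proof -
  have "(u, v) \<in> rtrancl_on (verts C) ((arcs_ends C)\<^sup>s)"
    using assms by (simp add: connected_conv)
  then show ?thesis
    by induction (use assms(2) in \<open>auto simp: arcs_ends_conv symcl_def\<close>)
qed

section \<open>Edge-ends at a vertex: one in \<open>F\<close>, two in \<open>Y\<close>\<close>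

locale cubic_factor = bidirected_digraph G arev
  for G :: "('v, 'e) pre_digraph" and arev :: "'e \<Rightarrow> 'e" +
  fixes F :: "'e set"
  assumes cubic: "cubic G" and factor: "is_factor 1 G arev F"
begin

abbreviation Y :: "('v, 'e) pre_digraph" where "Y \<equiv> delete_edges G F"
abbreviation X :: "('e set, 'e) pre_digraph" where "X \<equiv> contract_factor G arev F"

lemma Y_simps [simp]:
  "verts Y = verts G" "arcs Y = arcs G - F" "tail Y = tail G" "head Y = head G"
  by (simp_all add: delete_edges_def)

lemma X_simps [simp]: "verts X = edges_of arev F" "arcs X = arcs G - F"
  by (simp_all add: contract_factor_def)

lemma factor_arcs: "a \<in> F \<Longrightarrow> a \<in> arcs G"
  using factor by (auto simp: is_factor_def edge_subset_def)

lemma arev_factor_iff [simp]: "arev a \<in> F \<longleftrightarrow> a \<in> F"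
  using factor by (metis arev_arev edge_subset_def is_factor_def)

lemma factor_arc_unique:
  assumes "v \<in> verts G"
  shows "\<exists>a. {b \<in> F. tail G b = v} = {a}"
  using factor assms
  by (simp add: is_factor_def regular_def out_degree_def out_arcs_def card_1_singleton_iff)

text \<open>A loop of \<open>F\<close> would contribute two distinct arcs, \<open>a\<close> and
  \<open>arev a\<close>, at one vertex, where \<open>F\<close> has only one.\<close>

lemma factor_no_loop:
  assumes "a \<in> F"
  shows "tail G a \<noteq> head G a"
proof
  assume loop: "tail G a = head G a"
  have a: "a \<in> arcs G" using assms by (rule factor_arcs)
  then obtain b where "{b \<in> F. tail G b = tail G a} = {b}"
    using factor_arc_unique[of "tail G a"] by auto
  moreover have "a \<in> {b \<in> F. tail G b = tail G a}" "arev a \<in> {b \<in> F. tail G b = tail G a}"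
    using assms a loop by auto
  ultimately have "a = b" "arev a = b" by blast+
  then show False using arev_neq[OF a] by simp
qed

lemma card_out_arcs_Y:
  assumes "v \<in> verts G"
  shows "card (out_arcs Y v) = 2"
proof -
  obtain a where a: "{b \<in> F. tail G b = v} = {a}" using factor_arc_unique[OF assms] by blast
  have "out_arcs Y v = out_arcs G v - {a}" using a by (auto simp: out_arcs_def)
  moreover have "a \<in> out_arcs G v" using a factor_arcs by (auto simp: out_arcs_def)
  moreover have "card (out_arcs G v) = 3"
    using cubic assms by (simp add: regular_def out_degree_def)
  ultimately show ?thesis by simp
qed

lemma out_arc_Y_exists:
  assumes "v \<in> verts G"
  obtains a where "a \<in> arcs G" "a \<notin> F" "tail G a = v"
proof -
  have "out_arcs Y v \<noteq> {}" using card_out_arcs_Y[OF assms] by auto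
  then show thesis using that by (auto simp: out_arcs_def)
qed

section \<open>Edge-ends and transitions of the contracted graph\<close>

lemma tail_X_eq_iff:
  assumes "a \<in> arcs G" "f \<in> F"
  shows "tail X a = {f, arev f} \<longleftrightarrow> tail G a = tail G f \<or> tail G a = head G f"
proof
  assume "tail X a = {f, arev f}"
  then show "tail G a = tail G f \<or> tail G a = head G f"
    using factor_edge_at_mem(2)[OF factor, of "tail G a"] assms factor_arcs
    by (auto simp: contract_factor_def)
next
  assume "tail G a = tail G f \<or> tail G a = head G f"
  then show "tail X a = {f, arev f}"
    \<comment> \<open>The head of \<open>f\<close> is the tail of \<open>arev f\<close>, and both
      arcs give the same set \<open>{f, arev f}\<close>.\<close>
    using factor_edge_at_eqI[OF factor, of f] factor_edge_at_eqI[OF factor, of "arev f"]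
      assms factor_arcs
    by (auto simp: contract_factor_def)
qed

text \<open>Eliminates the vertices of \<open>X\<close>, so that colors can be compared at the two
  ends of \<open>f\<close> in \<open>G\<close>.\<close>

lemma transitions_X_iff:
  "t \<in> transitions X \<longleftrightarrow>
     (\<exists>f\<in>F. \<exists>a\<in>arcs G - F. \<exists>b\<in>arcs G - F. a \<noteq> b \<and> t = {a, b}
        \<and> {tail G a, tail G b} \<subseteq> {tail G f, head G f})"
proof -
  have "out_arcs X {f, arev f} = {a \<in> arcs G - F. tail G a \<in> {tail G f, head G f}}" if "f \<in> F" for f
    using that by (auto simp: tail_X_eq_iff)
  moreover have "t \<in> transitions X \<longleftrightarrow>
      (\<exists>f\<in>F. \<exists>a \<in> out_arcs X {f, arev f}. \<exists>b \<in> out_arcs X {f, arev f}. a \<noteq> b \<and> t = {a, b})"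
    unfolding transitions_def transitions_at_def edges_of_def X_simps by blast
  ultimately show ?thesis by simp blast
qed

lemma nontraversing_subset: "nontraversing_transitions G arev F \<subseteq> transitions X"
  by (auto simp: nontraversing_transitions_def transitions_def)

text \<open>The common tail is automatically an end of the contracted edge, since that edge is the
  factor edge at it.\<close>

lemma nontraversing_iff:
  assumes "{a, b} \<in> transitions X"
  shows "{a, b} \<in> nontraversing_transitions G arev F \<longleftrightarrow> tail G a = tail G b"
proof
  assume "{a, b} \<in> nontraversing_transitions G arev F"
  then show "tail G a = tail G b"
    by (auto simp: nontraversing_transitions_def)
next
  assume eq: "tail G a = tail G b"
  from assms obtain e where e: "e \<in> edges_of arev F" "{a, b} \<in> transitions_at X e"
    by (auto simp: transitions_def)
  then have ab: "a \<in> arcs G - F" "b \<in> arcs G - F" "tail X a = e"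
    by (auto simp: transitions_at_def doubleton_eq_iff)
  have "tail G a \<in> tail G ` e"
    using factor_edge_at_mem(2)[OF factor, of "tail G a"] ab by (auto simp: contract_factor_def)
  moreover have "{a, b} \<subseteq> out_arcs Y (tail G a)" using ab eq by auto
  ultimately show "{a, b} \<in> nontraversing_transitions G arev F"
    using e unfolding nontraversing_transitions_def by blast
qed

section \<open>Edge decompositions of \<open>X\<close> and switching colorings\<close>

text \<open>Exactly one end \<open>u\<close> of each edge of \<open>F\<close> has color true, and
  the edge-ends of the class at the contracted vertex are the two edge-ends of \<open>Y\<close> at
  \<open>u\<close>.\<close>

lemma color_class_is_factor:
  assumes c: "switching_coloring G F c"
  shows "is_factor 2 X arev {a \<in> arcs G - F. c (tail G a)}" (is "is_factor 2 X arev ?B")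
  unfolding is_factor_def regular_def
proof (intro conjI ballI)
  show "edge_subset X arev ?B"
    using c by (auto simp: edge_subset_def switching_coloring_def)
next
  fix e assume "e \<in> verts (X\<lparr>arcs := ?B\<rparr>)"
  then obtain f where f: "f \<in> F" "e = {f, arev f}" by (auto simp: edges_of_def)
  have "c (tail G f) \<noteq> c (head G f)" using c f by (auto simp: switching_coloring_def)
  then obtain u where u: "u \<in> {tail G f, head G f}" "c u"
    "\<And>w. w \<in> {tail G f, head G f} \<Longrightarrow> c w \<Longrightarrow> w = u" by auto
  have "out_arcs (X\<lparr>arcs := ?B\<rparr>) e = out_arcs Y u"
  proof (rule set_eqI)
    fix a
    have "c (tail G a) \<and> tail G a \<in> {tail G f, head G f} \<longleftrightarrow> tail G a = u" using u by blast
    then show "a \<in> out_arcs (X\<lparr>arcs := ?B\<rparr>) e \<longleftrightarrow> a \<in> out_arcs Y u"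
      using tail_X_eq_iff[OF _ f(1), of a] f(2) by auto
  qed
  moreover have "u \<in> verts G" using u(1) factor_arcs[OF f(1)] by auto
  ultimately show "out_degree (X\<lparr>arcs := ?B\<rparr>) e = 2"
    by (simp add: out_degree_def card_out_arcs_Y)
qed

lemma edge_decomposition_iff_switching_coloring:
  "(\<exists>B R. B \<union> R = arcs X \<and> B \<inter> R = {} \<and> is_factor 2 X arev B \<and> is_factor 2 X arev R
      \<and> traversing_transitions G arev F = color_switching_transitions X B R
      \<and> nontraversing_transitions G arev F = color_preserving_transitions X B R)
   \<longleftrightarrow> (\<exists>c. switching_coloring G F c)"
proof (intro iffI; elim exE conjE)
  fix B R
  assume BR: "B \<union> R = arcs X" "B \<inter> R = {}" and B: "is_factor 2 X arev B"
    and trav: "traversing_transitions G arev F = color_switching_transitions X B R"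
    and nontrav: "nontraversing_transitions G arev F = color_preserving_transitions X B R"
  \<comment> \<open>A vertex inherits the color of its edge-ends; \<open>color\<close> shows that
    these agree.\<close>
  define c where "c v \<longleftrightarrow> (\<exists>a\<in>B. tail G a = v)" for v
  have color: "a \<in> B \<longleftrightarrow> c (tail G a)" if a: "a \<in> arcs G - F" for a
  proof
    assume "c (tail G a)"
    then obtain b where b: "b \<in> B" "tail G b = tail G a" by (auto simp: c_def)
    show "a \<in> B"
    proof (cases "a = b")
      case False
      have b': "b \<in> arcs G - F" using b BR by auto
      obtain f where "f \<in> F" "tail G f = tail G a"
        using factor_arc_unique[of "tail G a"] a by auto
      then have t: "{a, b} \<in> transitions X"
        unfolding transitions_X_iff using False a b b'
        by (intro bexI[of _ f] bexI[of _ a] bexI[of _ b]) auto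
      \<comment> \<open>Two edge-ends with the same tail form a non-traversing transition, which
        preserves colors.\<close>
      then have "{a, b} \<notin> color_switching_transitions X B R"
        using nontraversing_iff[OF t] b nontrav by (auto simp: color_preserving_transitions_def)
      then show ?thesis using t b a BR by (auto simp: color_switching_transitions_def)
    qed (use b in simp)
  qed (auto simp: c_def)
  have "c (tail G a) = c (head G a)" if a: "a \<in> arcs G - F" for a
  proof -
    \<comment> \<open>Both arcs of an edge have the same color, which can thus be read off at either
      end.\<close>
    have "a \<in> B \<longleftrightarrow> arev a \<in> B"
      using B by (metis arev_arev edge_subset_def is_factor_def)
    then show ?thesis using color[of a] color[of "arev a"] a by auto
  qed
  moreover have "c (tail G f) \<noteq> c (head G f)" if f: "f \<in> F" for f
  proof -
    have "f \<in> arcs G" using f by (rule factor_arcs)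
    \<comment> \<open>One edge-end of \<open>Y\<close> at each end of \<open>f\<close> gives a
      traversing transition, which must switch colors.\<close>
    then obtain a b where a: "a \<in> arcs G - F" "tail G a = tail G f"
      and b: "b \<in> arcs G - F" "tail G b = head G f"
      by (metis DiffI head_in_verts tail_in_verts out_arc_Y_exists)
    have ne: "tail G a \<noteq> tail G b" using a b factor_no_loop[OF f] by simp
    then have t: "{a, b} \<in> transitions X"
      unfolding transitions_X_iff using f a b
      by (intro bexI[of _ f] bexI[of _ a] bexI[of _ b]) auto
    then have "{a, b} \<in> color_switching_transitions X B R"
      using nontraversing_iff[OF t] ne trav by (auto simp: traversing_transitions_def)
    then have "a \<in> B \<longleftrightarrow> b \<notin> B"
      using BR by (auto simp: color_switching_transitions_def)
    then show ?thesis using color[of a] color[of b] a b by simp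
  qed
  ultimately show "\<exists>c. switching_coloring G F c"
    unfolding switching_coloring_def by blast
next
  fix c assume c: "switching_coloring G F c"
  define B where "B = {a \<in> arcs G - F. c (tail G a)}"
  define R where "R = {a \<in> arcs G - F. \<not> c (tail G a)}"
  \<comment> \<open>The red class is the blue class of the negated coloring.\<close>
  have "switching_coloring G F (\<lambda>v. \<not> c v)"
    using c by (auto simp: switching_coloring_def)
  then have factors: "is_factor 2 X arev B" "is_factor 2 X arev R"
    using color_class_is_factor c unfolding B_def R_def by blast+
  have "t \<in> nontraversing_transitions G arev F \<longleftrightarrow> t \<notin> color_switching_transitions X B R"
    if t: "t \<in> transitions X" for t
  proof -
    obtain f a b where f: "f \<in> F" and ab: "a \<in> arcs G - F" "b \<in> arcs G - F" "t = {a, b}"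
      and ends: "{tail G a, tail G b} \<subseteq> {tail G f, head G f}"
      using t unfolding transitions_X_iff by blast
    have "c (tail G f) \<noteq> c (head G f)" using c f by (auto simp: switching_coloring_def)
    \<comment> \<open>The two ends of \<open>f\<close> have different colors, so among them equal
      color means equal vertex.\<close>
    then have "tail G a = tail G b \<longleftrightarrow> c (tail G a) = c (tail G b)" using ends by auto
    moreover have "t \<in> color_switching_transitions X B R \<longleftrightarrow> c (tail G a) \<noteq> c (tail G b)"
      using t ab by (auto simp: color_switching_transitions_def B_def R_def)
    ultimately show ?thesis using nontraversing_iff[of a b] t ab by blast
  qed
  then have nontrav: "nontraversing_transitions G arev F = color_preserving_transitions X B R"
    using nontraversing_subset unfolding color_preserving_transitions_def by blast
  \<comment> \<open>Traversing and color-preserving transitions are defined as complements, so the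
    second equality follows from the first.\<close>
  have "color_switching_transitions X B R \<subseteq> transitions X"
    by (auto simp: color_switching_transitions_def)
  then have "traversing_transitions G arev F = color_switching_transitions X B R"
    unfolding traversing_transitions_def nontrav color_preserving_transitions_def by blast
  moreover have "B \<union> R = arcs X" "B \<inter> R = {}" by (auto simp: B_def R_def)
  ultimately show "\<exists>B R. B \<union> R = arcs X \<and> B \<inter> R = {}
      \<and> is_factor 2 X arev B \<and> is_factor 2 X arev R
      \<and> traversing_transitions G arev F = color_switching_transitions X B R
      \<and> nontraversing_transitions G arev F = color_preserving_transitions X B R"
    using factors nontrav by blast
qed

section \<open>Components of \<open>Y\<close> are cycles\<close>

lemma sym_digraph_Y: "sym_digraph Y"
proof (intro_locales)
  show "wf_digraph Y" by unfold_locales auto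
  show "sym_digraph_axioms Y"
  proof
    show "symmetric Y"
      unfolding symmetric_conv
    proof
      fix a assume "a \<in> arcs Y"
      then show "\<exists>b\<in>arcs Y. tail Y a = head Y b \<and> head Y a = tail Y b"
        by (intro bexI[of _ "arev a"]) auto
    qed
  qed
qed

text \<open>Directed reachability suffices because \<open>arev\<close> makes it symmetric in
  \<open>Y\<close>.\<close>

definition component :: "'v \<Rightarrow> ('v, 'e) pre_digraph" where
  "component v = Y \<restriction> {w. v \<rightarrow>\<^sup>*\<^bsub>Y\<^esub> w}"

lemma mem_component: "v \<in> verts G \<Longrightarrow> v \<in> verts (component v)"
  by (simp add: component_def reachable_def)

lemma component_arc_eq:
  assumes "a \<in> arcs G - F"
  shows "component (tail G a) = component (head G a)"
proof -
  interpret Y: sym_digraph Y by (rule sym_digraph_Y)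
  have "tail G a \<rightarrow>\<^bsub>Y\<^esub> head G a" using assms by (auto simp: arcs_ends_conv)
  then have "tail G a \<rightarrow>\<^sup>*\<^bsub>Y\<^esub> head G a" by (rule Y.reachable_adjI)
  moreover from this have "head G a \<rightarrow>\<^sup>*\<^bsub>Y\<^esub> tail G a" by (rule Y.symmetric_reachable')
  ultimately have "{w. tail G a \<rightarrow>\<^sup>*\<^bsub>Y\<^esub> w} = {w. head G a \<rightarrow>\<^sup>*\<^bsub>Y\<^esub> w}"
    by (auto intro: Y.reachable_trans)
  then show ?thesis by (simp add: component_def)
qed

text \<open>No arc of \<open>Y\<close> leaves a reachable set, so each vertex keeps both its
  edge-ends of \<open>Y\<close>. Connectedness holds because the component is strongly
  connected.\<close>

lemma component_in_cycles:
  assumes v: "v \<in> verts G"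
  shows "component v \<in> cycles_of Y arev"
proof -
  interpret Y: sym_digraph Y by (rule sym_digraph_Y)
  have scc: "component v \<in> Y.sccs"
    unfolding component_def using v by (intro Y.induce_reachable_is_in_sccs) simp
  then have sub: "subgraph (component v) Y" and conn: "strongly_connected (component v)"
    by (auto simp: Y.sccs_def induced_subgraph_def)
  then interpret C: wf_digraph "component v" by (auto simp: subgraph_def)
  have arcs: "a \<in> arcs (component v) \<longleftrightarrow> a \<in> arcs G - F \<and> tail G a \<in> verts (component v)" for a
  proof -
    have "v \<rightarrow>\<^sup>*\<^bsub>Y\<^esub> head G a" if "a \<in> arcs G - F" "v \<rightarrow>\<^sup>*\<^bsub>Y\<^esub> tail G a"
      using that by (auto simp: arcs_ends_conv intro!: Y.reachable_adj_trans[OF that(2)])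
    then show ?thesis by (auto simp: component_def)
  qed
  have "edge_subset Y arev (arcs (component v))"
    unfolding edge_subset_def
    by (auto simp: component_def)
  moreover have "Digraph_Component.connected (component v)"
    using conn by (intro C.connectedI C.reachable_mk_symmetricI) (auto simp: strongly_connected_def)
  moreover have "regular 2 (component v)"
    unfolding regular_def
  proof
    fix w assume w: "w \<in> verts (component v)"
    have "tail (component v) = tail G" by (simp add: component_def)
    then have "out_arcs (component v) w = out_arcs Y w"
      using w by (auto simp: arcs)
    moreover have "w \<in> verts G" using w sub by (auto simp: subgraph_def)
    ultimately show "out_degree (component v) w = 2" by (simp add: out_degree_def card_out_arcs_Y)
  qed
  ultimately show ?thesis using sub by (simp add: cycles_of_def)
qed

section \<open>Bipartiteness of the auxiliary graph\<close>

lemma special_iff_switching_coloring: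
  "special G arev F \<longleftrightarrow> (\<exists>c. switching_coloring G F c)"
proof
  assume "special G arev F"
  then obtain U W where UW: "cycles_of Y arev = U \<union> W" "U \<inter> W = {}"
    and bip: "parcs (aux_graph G arev F) \<subseteq> U \<times> W \<union> W \<times> U"
    by (auto simp: special_def bipartite_def aux_graph_def Let_def)
  \<comment> \<open>Each vertex is colored by the side of the bipartition containing its
    component.\<close>
  have "switching_coloring G F (\<lambda>v. component v \<in> U)"
    unfolding switching_coloring_def
  proof (intro conjI ballI)
    fix a assume "a \<in> arcs G - F"
    then show "(component (tail G a) \<in> U) = (component (head G a) \<in> U)"
      by (simp add: component_arc_eq)
  next
    fix f assume f: "f \<in> F"
    let ?C = "component (tail G f)" and ?D = "component (head G f)"
    have ends: "tail G f \<in> verts G" "head G f \<in> verts G" using factor_arcs[OF f] by auto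
    \<comment> \<open>If the two components coincide, \<open>f\<close> is a chord and yields a loop;
      hence the pair is an arc of the auxiliary graph in either case.\<close>
    have "f \<notin> arcs ?C" using f by (simp add: component_def)
    then have "(?C, ?D) \<in> parcs (aux_graph G arev F)"
      using f ends mem_component[of "tail G f"] mem_component[of "head G f"]
      by (auto simp: aux_graph_def Let_def joined_by_def has_chord_in_def component_in_cycles)
    then show "(?C \<in> U) \<noteq> (?D \<in> U)" using bip UW by blast
  qed
  then show "\<exists>c. switching_coloring G F c" by blast
next
  assume "\<exists>c. switching_coloring G F c"
  then obtain c where c: "switching_coloring G F c" by blast
  have const: "c u = c v" if C: "C \<in> cycles_of Y arev" and uv: "u \<in> verts C" "v \<in> verts C" for C u v
  proof (rule connected_constant[OF _ _ uv])
    have sub: "subgraph C Y" and "Digraph_Component.connected C" using C by (auto simp: cycles_of_def)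
    then show "Digraph_Component.connected C" by simp
    fix a assume "a \<in> arcs C"
    then show "c (tail C a) = c (head C a)"
      using sub c by (auto simp: subgraph_def compatible_def switching_coloring_def)
  qed
  \<comment> \<open>By \<open>const\<close>, one vertex of color true in a cycle means that all its
    vertices have this color.\<close>
  define U where "U = {C \<in> cycles_of Y arev. \<exists>v\<in>verts C. c v}"
  have U: "C \<in> U \<longleftrightarrow> c v" if "C \<in> cycles_of Y arev" "v \<in> verts C" for C v
    using that const unfolding U_def by blast
  have flip: "C \<in> U \<longleftrightarrow> D \<notin> U"
    if "C \<in> cycles_of Y arev" "D \<in> cycles_of Y arev" "joined_by G F C D" for C D
    using that U c by (auto simp: joined_by_def switching_coloring_def)
  have "parcs (aux_graph G arev F) \<subseteq> U \<times> (cycles_of Y arev - U) \<union> (cycles_of Y arev - U) \<times> U"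
  proof
    fix p assume "p \<in> parcs (aux_graph G arev F)"
    \<comment> \<open>A chord gives \<open>joined_by\<close> with \<open>C = D\<close>, which
      \<open>flip\<close> refutes; this excludes loops.\<close>
    then obtain C D where p: "p = (C, D)" "C \<in> cycles_of Y arev" "D \<in> cycles_of Y arev"
      "joined_by G F C D"
      by (auto simp: aux_graph_def Let_def joined_by_def has_chord_in_def)
    then show "p \<in> U \<times> (cycles_of Y arev - U) \<union> (cycles_of Y arev - U) \<times> U"
      using flip by blast
  qed
  moreover have "pverts (aux_graph G arev F) = U \<union> (cycles_of Y arev - U)"
    by (auto simp: aux_graph_def Let_def U_def)
  ultimately show "special G arev F"
    unfolding special_def bipartite_def with_proj_simps by blast
qed

end

theorem theorem7:
  fixes G :: "('v, 'e) pre_digraph" and arev :: "'e \<Rightarrow> 'e" and F :: "'e set"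
    and X :: "('e set, 'e) pre_digraph"
  assumes "bidirected_digraph G arev"
    and "fin_digraph G"
    and "Digraph_Component.connected G"
    and "cubic G"
    and "is_factor 1 G arev F"
    and "X = contract_factor G arev F"
  shows "(\<exists>B R. B \<union> R = arcs X \<and> B \<inter> R = {}
            \<and> is_factor 2 X arev B \<and> is_factor 2 X arev R
            \<and> traversing_transitions G arev F = color_switching_transitions X B R
            \<and> nontraversing_transitions G arev F = color_preserving_transitions X B R)
         \<longleftrightarrow> special G arev F"
proof -
  interpret cubic_factor G arev F
    using assms(1,4,5) by (intro cubic_factor.intro cubic_factor_axioms.intro)
  show ?thesis
    unfolding \<open>X = contract_factor G arev F\<close>
    using edge_decomposition_iff_switching_coloring special_iff_switching_coloring by simp
qed

end
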